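(* Let $\rho,\kappa>-1$ be real numbers, $m\ge0$ an integer, and let $a,b,c$ be parameters with $c\ne0,-1,-2,\dots$. For $z,w\in\mathbb{D}^*$ we have $$\sum_{n=0}^{+\infty}\frac{(a)_n}{n!\,(c)_n}\,\mathcal{Z}^{\kappa,\rho}_{m,n}(z,\bar z)\,\overline{\mathcal{Z}^{\kappa,\rho}_{m,n}(w,\bar w)}=R^{\kappa,\rho}_m\Big({}_1F_1(a;c;z\bar w)\Big)$$ and $$\sum_{n=0}^{+\infty}\frac{(a)_n(b)_n}{n!\,(c)_n}\,\mathcal{Z}^{\kappa,\rho}_{m,n}(z,\bar z)\,\overline{\mathcal{Z}^{\kappa,\rho}_{m,n}(w,\bar w)}=R^{\kappa,\rho}_m\Big({}_2F_1(a,b;c;z\bar w)\Big).$$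
   Context: Let $\mathbb{D}=\{z\in\mathbb{C}:|z|<1\}$ and $\mathbb{D}^*=\mathbb{D}\setminus\{0\}$; derivatives in $z$ and $\bar w$ are Wirtinger derivatives and $(a)_n=a(a+1)\cdots(a+n-1)$. The fractional Zernike functions on $\mathbb{D}^*$ are $$\mathcal{Z}^{\kappa,\rho}_{m,n}(z,\bar z)=(-1)^m z^{-\rho}(1-|z|^2)^{-\kappa}\frac{\partial^m}{\partial z^m}\Big(z^{n+\rho}(1-|z|^2)^{\kappa+m}\Big),$$ the powers $z^{-\rho}$ and $z^{n+\rho}$ being taken with the same local branch (the result does not depend on the choice). The differential operator $R^{\kappa,\rho}_m$ acts on a sufficiently differentiable function $f$ of $(z,w)$ by $$R^{\kappa,\rho}_m f=\frac{1}{(z\bar w)^\rho(1-|z|^2)^\kappa(1-|w|^2)^\kappa}\,\frac{\partial^{2m}}{\partial z^m\partial\bar w^m}\Big((z\bar w)^\rho(1-|z|^2)^{\kappa+m}(1-|w|^2)^{\kappa+m}f\Big),$$ the two occurrences of $(z\bar w)^\rho$ using the same local branch. ${}_1F_1(a;c;x)=\sum_{n\ge0}\frac{(a)_n}{(c)_n}\frac{x^n}{n!}$ and ${}_2F_1(a,b;c;x)=\sum_{n\ge0}\frac{(a)_n(b)_n}{(c)_n}\frac{x^n}{n!}$ are the confluent and Gauss hypergeometric functions. *)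

theory Defs
  imports "HOL-Complex_Analysis.Complex_Analysis"
begin

definition partial_x :: "(complex \<Rightarrow> complex) \<Rightarrow> complex \<Rightarrow> complex" where
  "partial_x f z = vector_derivative (\<lambda>t::real. f (z + of_real t)) (at 0)"

definition partial_y :: "(complex \<Rightarrow> complex) \<Rightarrow> complex \<Rightarrow> complex" where
  "partial_y f z = vector_derivative (\<lambda>t::real. f (z + \<i> * of_real t)) (at 0)"

definition wirtinger :: "(complex \<Rightarrow> complex) \<Rightarrow> complex \<Rightarrow> complex" where
  "wirtinger f z = (partial_x f z - \<i> * partial_y f z) / 2"

definition wirtinger_bar :: "(complex \<Rightarrow> complex) \<Rightarrow> complex \<Rightarrow> complex" where
  "wirtinger_bar f z = (partial_x f z + \<i> * partial_y f z) / 2"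

text \<open>
  Since \<open>vector_derivative\<close> is total, its value is unspecified where the partial derivative does
  not exist. For real-differentiable functions the operators are the usual ones.
\<close>

lemma wirtinger_has_derivative:
  assumes "(f has_derivative D) (at z)"
  shows "wirtinger f z = (D 1 - \<i> * D \<i>) / 2"
    and "wirtinger_bar f z = (D 1 + \<i> * D \<i>) / 2"
proof -
  have lin: "linear D" using assms has_derivative_linear by blast
  have dir: "vector_derivative (\<lambda>t::real. f (z + v * of_real t)) (at 0) = D v" for v :: complex
  proof -
    have 1: "((\<lambda>t::real. z + v * of_real t) has_derivative (\<lambda>t. v * of_real t)) (at 0)"
      by (auto intro!: derivative_eq_intros)
    have "((\<lambda>t::real. f (z + v * of_real t)) has_derivative (\<lambda>t. D (v * of_real t))) (at 0)"
      using has_derivative_compose[OF 1, of f D] assms by simp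
    moreover have "(\<lambda>t. D (v * of_real t)) = (\<lambda>t. t *\<^sub>R D v)"
      using linear_cmul[OF lin, of _ v] by (simp add: scaleR_conv_of_real mult.commute)
    ultimately show ?thesis
      by (simp add: has_vector_derivative_def vector_derivative_at)
  qed
  show "wirtinger f z = (D 1 - \<i> * D \<i>) / 2" "wirtinger_bar f z = (D 1 + \<i> * D \<i>) / 2"
    using dir[of 1] dir[of \<i>]
    by (simp_all add: wirtinger_def wirtinger_bar_def partial_x_def partial_y_def)
qed

text \<open>Wirtinger derivatives of a function of two complex variables.\<close>

definition wirtinger_fst :: "(complex \<Rightarrow> complex \<Rightarrow> complex) \<Rightarrow> complex \<Rightarrow> complex \<Rightarrow> complex" where
  "wirtinger_fst f z w = wirtinger (\<lambda>\<zeta>. f \<zeta> w) z"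

definition wirtinger_bar_snd :: "(complex \<Rightarrow> complex \<Rightarrow> complex) \<Rightarrow> complex \<Rightarrow> complex \<Rightarrow> complex" where
  "wirtinger_bar_snd f z w = wirtinger_bar (\<lambda>\<omega>. f z \<omega>) w"

text \<open>
  Complex powers are taken with respect to an explicit local branch \<open>L\<close> of the logarithm.
  The principal branch used by \<open>powr\<close> would not do: it is discontinuous along the negative reals,
  so the derivatives below would not exist there.
\<close>

definition local_log_branch :: "(complex \<Rightarrow> complex) \<Rightarrow> complex \<Rightarrow> bool" where
  "local_log_branch L z \<longleftrightarrow>
     (\<exists>U. open U \<and> z \<in> U \<and> L holomorphic_on U \<and> (\<forall>\<zeta>\<in>U. exp (L \<zeta>) = \<zeta>))"

definition branch_powr :: "(complex \<Rightarrow> complex) \<Rightarrow> complex \<Rightarrow> real \<Rightarrow> complex" where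
  "branch_powr L z s = exp (of_real s * L z)"

lemma local_log_branch_exists:
  assumes "z \<noteq> 0"
  shows "local_log_branch (\<lambda>\<zeta>. Ln z + Ln (\<zeta> / z)) z"
  unfolding local_log_branch_def
proof (intro exI conjI ballI)
  let ?U = "(\<lambda>\<zeta>. \<zeta> / z) -` {\<zeta>. Re \<zeta> > 0}"
  show "open ?U"
    using assms by (intro open_vimage continuous_intros open_halfspace_Re_gt) auto
  show "z \<in> ?U" using assms by simp
  show "(\<lambda>\<zeta>. Ln z + Ln (\<zeta> / z)) holomorphic_on ?U"
    using assms by (intro holomorphic_intros) (auto simp: complex_nonpos_Reals_iff)
  show "exp (Ln z + Ln (\<zeta> / z)) = \<zeta>" if "\<zeta> \<in> ?U" for \<zeta>
  proof -
    have "\<zeta> / z \<noteq> 0" using that by auto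
    then show ?thesis using assms by (simp add: exp_add)
  qed
qed

definition disc_weight :: "real \<Rightarrow> complex \<Rightarrow> complex" where
  "disc_weight s z = of_real ((1 - (cmod z)\<^sup>2) powr s)"

definition fractional_zernike ::
    "(complex \<Rightarrow> complex) \<Rightarrow> real \<Rightarrow> real \<Rightarrow> nat \<Rightarrow> nat \<Rightarrow> complex \<Rightarrow> complex" where
  "fractional_zernike L \<kappa> \<rho> m n z =
     (-1) ^ m * branch_powr L z (- \<rho>) * disc_weight (- \<kappa>) z *
     (wirtinger ^^ m)
       (\<lambda>\<zeta>. branch_powr L \<zeta> (real n + \<rho>) * disc_weight (\<kappa> + real m) \<zeta>) z"

text \<open>Here \<open>L\<close> is a branch of the logarithm near the point \<open>z * cnj w\<close>.\<close>

definition zernike_operator ::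
    "(complex \<Rightarrow> complex) \<Rightarrow> real \<Rightarrow> real \<Rightarrow> nat \<Rightarrow>
     (complex \<Rightarrow> complex \<Rightarrow> complex) \<Rightarrow> complex \<Rightarrow> complex \<Rightarrow> complex" where
  "zernike_operator L \<kappa> \<rho> m f z w =
     1 / (branch_powr L (z * cnj w) \<rho> * disc_weight \<kappa> z * disc_weight \<kappa> w) *
     (wirtinger_fst ^^ m) ((wirtinger_bar_snd ^^ m)
       (\<lambda>\<zeta> \<omega>. branch_powr L (\<zeta> * cnj \<omega>) \<rho> * disc_weight (\<kappa> + real m) \<zeta> *
               disc_weight (\<kappa> + real m) \<omega> * f \<zeta> \<omega>)) z w"

definition hypergeo_1F1 :: "complex \<Rightarrow> complex \<Rightarrow> complex \<Rightarrow> complex" where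
  "hypergeo_1F1 a c x = (\<Sum>n. pochhammer a n / pochhammer c n * (x ^ n / fact n))"

definition hypergeo_2F1 :: "complex \<Rightarrow> complex \<Rightarrow> complex \<Rightarrow> complex \<Rightarrow> complex" where
  "hypergeo_2F1 a b c x =
     (\<Sum>n. pochhammer a n * pochhammer b n / pochhammer c n * (x ^ n / fact n))"

lemma hypergeo_1F1_eval_fps: "hypergeo_1F1 a c x = eval_fps (fps_hypergeo [a] [c] 1) x"
  by (simp add: hypergeo_1F1_def eval_fps_def fps_hypergeo_nth)

lemma hypergeo_2F1_eval_fps: "hypergeo_2F1 a b c x = eval_fps (fps_hypergeo [a, b] [c] 1) x"
  by (simp add: hypergeo_2F1_def eval_fps_def fps_hypergeo_nth)

end

theory Submission
  imports Defs
begin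

text \<open>
  Both identities are instances of one fact: for every power series
  \<open>f u = (\<Sum>n. a n * u ^ n)\<close> convergent in the unit disc, the series of the products
  \<open>Z n z * cnj (Z n w)\<close> of fractional Zernike functions with coefficients \<open>a n\<close> sums to \<open>R f\<close>
  (\<open>zernike_generating_function\<close>). Formally this is clear, since \<open>R\<close> applied to
  \<open>(z * cnj w) ^ n\<close> separates the variables and gives exactly the \<open>n\<close>-th product; the content is that
  \<open>R\<close> may be applied term by term.

  No interchange of limits is made for the Wirtinger operators themselves. The derivatives are
  computed in closed form, by the Leibniz rule between two sequences of successive derivatives.
  The weight \<open>(1 - \<bar>z\<bar>\<^sup>2) powr s\<close> yields \<open>weight_deriv s k\<close>. A power series multiplied by a branch
  of \<open>u powr \<rho>\<close> stays of this kind under differentiation: as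
  \<open>u * d/du\<close> multiplies \<open>u ^ n * u powr \<rho>\<close> by \<open>n + \<rho>\<close>, the \<open>l\<close>-th derivative is the series with
  coefficients \<open>a n * falling (n + \<rho>) l\<close>, divided by \<open>u ^ l\<close>. Only ordinary termwise
  differentiation of power series enters here, and multiplying coefficients by polynomials in \<open>n\<close>
  keeps the series convergent on the disc.

  Consequently (\<open>fractional_zernike_explicit\<close>) \<open>Z n z\<close> is, up to sign, \<open>z ^ n\<close> times a finite
  combination of \<open>falling (n + \<rho>) (m - k)\<close> over \<open>k \<le> m\<close>, whose coefficients
  \<open>zernike_coeff \<kappa> m k z\<close> do not depend on \<open>n\<close>. The same coefficients appear in \<open>R f\<close>
  (\<open>zernike_operator_explicit\<close>), which is a double sum over \<open>k, j \<le> m\<close> of convergent power series in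
  \<open>z * cnj w\<close>. Interchanging this finite double sum with the sum over \<open>n\<close> finishes the argument. The
  powers of \<open>z\<close>, \<open>w\<close> and \<open>z * cnj w\<close> with exponent \<open>\<rho>\<close> cancel separately on each side, so both
  sides are independent of the chosen branches. Convergence of the hypergeometric series on the
  disc follows from the ratio of consecutive coefficients.
\<close>

section \<open>Wirtinger derivatives along chains of functions\<close>

text \<open>
  A relational form of both Wirtinger derivatives, \<open>\<sigma> = 1\<close> being the one in \<open>z\<close> and \<open>\<sigma> = - 1\<close> the one
  in \<open>cnj z\<close>. It records real differentiability, which the total operators do not, so that the rules
  of calculus hold.
\<close>

definition has_wirtinger :: "complex \<Rightarrow> (complex \<Rightarrow> complex) \<Rightarrow> complex \<Rightarrow> complex \<Rightarrow> bool" where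
  "has_wirtinger \<sigma> f d z \<longleftrightarrow> (\<exists>D. (f has_derivative D) (at z) \<and> d = (D 1 - \<sigma> * \<i> * D \<i>) / 2)"

lemma wirtinger_eqI: "has_wirtinger 1 f d z \<Longrightarrow> wirtinger f z = d"
  by (auto simp: has_wirtinger_def wirtinger_has_derivative)

lemma wirtinger_bar_eqI: "has_wirtinger (-1) f d z \<Longrightarrow> wirtinger_bar f z = d"
  by (auto simp: has_wirtinger_def wirtinger_has_derivative)

lemma has_wirtinger_const: "has_wirtinger \<sigma> (\<lambda>_. c) 0 z"
  by (auto simp: has_wirtinger_def intro!: exI[of _ "\<lambda>_. 0"])

lemma has_wirtinger_add:
  assumes "has_wirtinger \<sigma> f d z" "has_wirtinger \<sigma> g e z"
  shows "has_wirtinger \<sigma> (\<lambda>\<zeta>. f \<zeta> + g \<zeta>) (d + e) z"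
proof -
  obtain D E where "(f has_derivative D) (at z)" "d = (D 1 - \<sigma> * \<i> * D \<i>) / 2"
    "(g has_derivative E) (at z)" "e = (E 1 - \<sigma> * \<i> * E \<i>) / 2"
    using assms by (auto simp: has_wirtinger_def)
  then show ?thesis
    unfolding has_wirtinger_def
    by (intro exI[of _ "\<lambda>h. D h + E h"] conjI has_derivative_add) (auto simp: field_simps)
qed

lemma has_wirtinger_mult:
  assumes "has_wirtinger \<sigma> f d z" "has_wirtinger \<sigma> g e z"
  shows "has_wirtinger \<sigma> (\<lambda>\<zeta>. f \<zeta> * g \<zeta>) (d * g z + f z * e) z"
proof -
  obtain D E where D: "(f has_derivative D) (at z)" "(g has_derivative E) (at z)"
    and d: "d = (D 1 - \<sigma> * \<i> * D \<i>) / 2" and e: "e = (E 1 - \<sigma> * \<i> * E \<i>) / 2"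
    using assms by (auto simp: has_wirtinger_def)
  show ?thesis
    unfolding has_wirtinger_def d e
    by (intro exI[of _ "\<lambda>h. f z * E h + D h * g z"] conjI has_derivative_mult D)
      (simp add: field_simps)
qed

lemma has_wirtinger_cmult:
  "has_wirtinger \<sigma> f d z \<Longrightarrow> has_wirtinger \<sigma> (\<lambda>\<zeta>. c * f \<zeta>) (c * d) z"
  using has_wirtinger_mult[OF has_wirtinger_const[of \<sigma> c z]] by simp

lemma has_wirtinger_sum:
  assumes "\<And>i. i \<in> I \<Longrightarrow> has_wirtinger \<sigma> (f i) (d i) z"
  shows "has_wirtinger \<sigma> (\<lambda>\<zeta>. \<Sum>i\<in>I. f i \<zeta>) (\<Sum>i\<in>I. d i) z"
  using assms
  by (induction I rule: infinite_finite_induct) (auto intro: has_wirtinger_const has_wirtinger_add)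

lemma has_wirtinger_transform:
  assumes "has_wirtinger \<sigma> f d z" "open U" "z \<in> U" "\<And>\<zeta>. \<zeta> \<in> U \<Longrightarrow> f \<zeta> = g \<zeta>"
  shows "has_wirtinger \<sigma> g d z"
  using assms has_derivative_transform_within_open[of f _ z UNIV U g]
  unfolding has_wirtinger_def by auto

lemma has_wirtinger_holomorphic:
  assumes "(f has_field_derivative d) (at z)"
  shows "has_wirtinger 1 f d z"
  using assms unfolding has_wirtinger_def has_field_derivative_def
  by (intro exI[of _ "(*) d"]) (auto simp: algebra_simps)

lemma has_wirtinger_antiholomorphic:
  assumes "(f has_field_derivative d) (at (cnj z))"
  shows "has_wirtinger (-1) (\<lambda>\<zeta>. f (cnj \<zeta>)) d z"
proof -
  have "((\<lambda>\<zeta>. f (cnj \<zeta>)) has_derivative (\<lambda>h. d * cnj h)) (at z)"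
    using has_derivative_compose[of cnj cnj z UNIV f "(*) d"] assms
      bounded_linear_imp_has_derivative[OF bounded_linear_cnj, of "at z"]
    by (simp add: has_field_derivative_def)
  then show ?thesis
    unfolding has_wirtinger_def by (intro exI[of _ "\<lambda>h. d * cnj h"]) (auto simp: algebra_simps)
qed

lemma has_wirtinger_cnj:
  assumes "has_wirtinger 1 f d z"
  shows "has_wirtinger (-1) (\<lambda>\<zeta>. cnj (f \<zeta>)) (cnj d) z"
proof -
  obtain D where D: "(f has_derivative D) (at z)" and d: "d = (D 1 - 1 * \<i> * D \<i>) / 2"
    using assms by (auto simp: has_wirtinger_def)
  show ?thesis
    unfolding has_wirtinger_def d
    by (intro exI[of _ "\<lambda>h. cnj (D h)"] conjI has_derivative_cnj D) simp
qed

text \<open>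
  Iterated derivatives are handled through a guessed sequence of functions, each the derivative of
  the preceding one on the whole of \<open>U\<close>. The sequence is then the sequence of iterates
  (\<open>wirtinger_chain_funpow\<close>), and differentiability is carried along.
\<close>

definition wirtinger_chain :: "complex \<Rightarrow> complex set \<Rightarrow> (nat \<Rightarrow> complex \<Rightarrow> complex) \<Rightarrow> bool" where
  "wirtinger_chain \<sigma> U F \<longleftrightarrow> (\<forall>i. \<forall>z\<in>U. has_wirtinger \<sigma> (F i) (F (Suc i) z) z)"

text \<open>
  Openness of \<open>U\<close> is what makes the induction work: the \<open>m\<close>-th iterate agrees with \<open>F m\<close> near each
  point, hence has the same derivative there.
\<close>

lemma wirtinger_chain_funpow:
  assumes D: "\<And>f d z. has_wirtinger \<sigma> f d z \<Longrightarrow> D f z = d"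
    and "open U" and chain: "wirtinger_chain \<sigma> U F"
    and "\<And>z. z \<in> U \<Longrightarrow> f z = F 0 z" and "z \<in> U"
  shows "(D ^^ m) f z = F m z"
  using \<open>z \<in> U\<close>
proof (induction m arbitrary: z)
  case (Suc m)
  have "has_wirtinger \<sigma> (F m) (F (Suc m) z) z"
    using chain Suc.prems by (auto simp: wirtinger_chain_def)
  then have "has_wirtinger \<sigma> ((D ^^ m) f) (F (Suc m) z) z"
    by (rule has_wirtinger_transform[OF _ \<open>open U\<close> \<open>z \<in> U\<close>]) (simp add: Suc.IH)
  then show ?case by (simp add: D)
qed (simp add: assms(4))

text \<open>
  Pascal's rule in the shape in which it drives the induction step of the Leibniz formula:
  \<open>g (Suc i)\<close> and \<open>t (Suc k)\<close> stand for the derivatives of \<open>g i\<close> and \<open>t k\<close>.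
\<close>

lemma binomial_sum_Suc:
  fixes g t :: "nat \<Rightarrow> 'a :: comm_semiring_1"
  shows "(\<Sum>k\<le>m. of_nat (m choose k) * (g (Suc (m - k)) * t k + g (m - k) * t (Suc k)))
    = (\<Sum>k\<le>Suc m. of_nat (Suc m choose k) * (g (Suc m - k) * t k))"
proof -
  have "(\<Sum>k\<le>Suc m. of_nat (Suc m choose k) * (g (Suc m - k) * t k))
    = g (Suc m) * t 0 + (\<Sum>k\<le>m. of_nat (m choose Suc k) * (g (m - k) * t (Suc k)))
      + (\<Sum>k\<le>m. of_nat (m choose k) * (g (m - k) * t (Suc k)))"
    by (subst sum.atMost_Suc_shift) (simp add: algebra_simps sum.distrib)
  also have "g (Suc m) * t 0 + (\<Sum>k\<le>m. of_nat (m choose Suc k) * (g (m - k) * t (Suc k)))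
    = (\<Sum>k\<le>Suc m. of_nat (m choose k) * (g (Suc m - k) * t k))"
    by (subst sum.atMost_Suc_shift) simp
  also have "\<dots> = (\<Sum>k\<le>m. of_nat (m choose k) * (g (Suc (m - k)) * t k))"
    by (simp add: Suc_diff_le binomial_eq_0)
  finally show ?thesis by (simp add: algebra_simps sum.distrib)
qed

text \<open>
  The Leibniz formula: it expresses that the binomial combinations are again successive derivatives.
\<close>

lemma wirtinger_chain_mult:
  assumes "wirtinger_chain \<sigma> U G" "wirtinger_chain \<sigma> U T"
  shows "wirtinger_chain \<sigma> U (\<lambda>m z. \<Sum>k\<le>m. of_nat (m choose k) * (G (m - k) z * T k z))"
  unfolding wirtinger_chain_def
proof (intro allI ballI)
  fix m z assume "z \<in> U"
  then show "has_wirtinger \<sigma> (\<lambda>z. \<Sum>k\<le>m. of_nat (m choose k) * (G (m - k) z * T k z))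
      (\<Sum>k\<le>Suc m. of_nat (Suc m choose k) * (G (Suc m - k) z * T k z)) z"
    unfolding binomial_sum_Suc[of m "\<lambda>i. G i z" "\<lambda>i. T i z", symmetric]
    using assms
    by (intro has_wirtinger_sum has_wirtinger_cmult has_wirtinger_mult)
      (auto simp: wirtinger_chain_def)
qed

lemma wirtinger_chain_lincomb:
  assumes "\<And>j. j \<in> J \<Longrightarrow> wirtinger_chain \<sigma> U (F j)"
  shows "wirtinger_chain \<sigma> U (\<lambda>i z. \<Sum>j\<in>J. c j * F j i z)"
  using assms unfolding wirtinger_chain_def
  by (auto intro!: has_wirtinger_sum has_wirtinger_cmult)

lemma wirtinger_chain_cmult:
  "wirtinger_chain \<sigma> U F \<Longrightarrow> wirtinger_chain \<sigma> U (\<lambda>i z. c * F i z)"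
  unfolding wirtinger_chain_def by (auto intro!: has_wirtinger_cmult)

lemma wirtinger_chain_cnj:
  "wirtinger_chain 1 U F \<Longrightarrow> wirtinger_chain (-1) U (\<lambda>i z. cnj (F i z))"
  unfolding wirtinger_chain_def by (auto intro!: has_wirtinger_cnj)

text \<open>
  Each of the two partial operators keeps the other variable as a parameter, so its iterates are
  iterates of a one-variable operator.
\<close>

lemma wirtinger_fst_funpow:
  "(wirtinger_fst ^^ m) F z w = (wirtinger ^^ m) (\<lambda>\<zeta>. F \<zeta> w) z"
  by (induction m arbitrary: z) (auto simp: wirtinger_fst_def)

lemma wirtinger_bar_snd_funpow:
  "(wirtinger_bar_snd ^^ m) F z w = (wirtinger_bar ^^ m) (F z) w"
  by (induction m arbitrary: w) (auto simp: wirtinger_bar_snd_def)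

section \<open>The weight\<close>

definition falling :: "complex \<Rightarrow> nat \<Rightarrow> complex" where
  "falling x k = (\<Prod>j<k. x - of_nat j)"

lemma falling_0 [simp]: "falling x 0 = 1"
  and falling_Suc: "falling x (Suc k) = falling x k * (x - of_nat k)"
  by (simp_all add: falling_def)

lemma cnj_falling: "cnj (falling x k) = falling (cnj x) k"
  by (simp add: falling_def)

text \<open>
  The \<open>k\<close>-th derivative in \<open>z\<close> of \<open>(1 - z * cnj z) powr s\<close>, as found by treating \<open>cnj z\<close> as a constant.
\<close>

definition weight_deriv :: "real \<Rightarrow> nat \<Rightarrow> complex \<Rightarrow> complex" where
  "weight_deriv s k z = falling (of_real s) k * (- cnj z) ^ k * disc_weight (s - real k) z"

lemma weight_deriv_0: "weight_deriv s 0 = disc_weight s"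
  by (simp add: weight_deriv_def fun_eq_iff)

lemma one_minus_norm_pos: "z \<in> ball 0 1 \<Longrightarrow> 0 < 1 - (cmod z)\<^sup>2"
  by (simp add: power_less_one_iff abs_square_less_1)

lemma has_wirtinger_disc_weight:
  assumes "z \<in> ball 0 1"
  shows "has_wirtinger 1 (disc_weight s) (- of_real s * cnj z * disc_weight (s - 1) z) z"
proof -
  (* Squared real and imaginary parts are differentiable everywhere, unlike the modulus. *)
  let ?q = "\<lambda>\<zeta>::complex. 1 - ((Re \<zeta>)\<^sup>2 + (Im \<zeta>)\<^sup>2)"
  let ?D = "\<lambda>h. complex_of_real (s * ?q z powr (s - 1) * (- 2 * (Re z * Re h + Im z * Im h)))"
  have pos: "?q z > 0" using one_minus_norm_pos[OF assms] by (simp add: cmod_power2)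
  have q: "(?q has_derivative (\<lambda>h. - 2 * (Re z * Re h + Im z * Im h))) (at z)"
    by (auto intro!: derivative_eq_intros simp: algebra_simps)
  have "((\<lambda>x. x powr s) has_derivative (\<lambda>h. s * ?q z powr (s - 1) * h)) (at (?q z))"
    using has_real_derivative_powr[OF pos, of s]
    by (simp add: has_field_derivative_def)
  from has_derivative_compose[OF q this]
  have "((\<lambda>\<zeta>. ?q \<zeta> powr s) has_derivative
      (\<lambda>h. s * ?q z powr (s - 1) * (- 2 * (Re z * Re h + Im z * Im h)))) (at z)" .
  from has_derivative_of_real[OF this]
  have "((\<lambda>\<zeta>. complex_of_real (?q \<zeta> powr s)) has_derivative ?D) (at z)" .
  then have "(disc_weight s has_derivative ?D) (at z)"
    by (simp add: disc_weight_def[abs_def] cmod_power2)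
  moreover have "- of_real s * cnj z * disc_weight (s - 1) z = (?D 1 - 1 * \<i> * ?D \<i>) / 2"
    by (simp add: disc_weight_def cmod_power2 complex_eq_iff)
  ultimately show ?thesis unfolding has_wirtinger_def by blast
qed

lemma wirtinger_chain_weight_deriv: "wirtinger_chain 1 (ball 0 1) (weight_deriv s)"
  unfolding wirtinger_chain_def
proof (intro allI ballI)
  fix k and z :: complex assume z: "z \<in> ball 0 1"
  have cnj0: "has_wirtinger 1 cnj 0 z"
    unfolding has_wirtinger_def
    by (intro exI[of _ cnj] conjI bounded_linear_imp_has_derivative bounded_linear_cnj) auto
  have pow: "has_wirtinger 1 (\<lambda>z. (- cnj z) ^ k) 0 z"
  proof (induction k)
    case 0 then show ?case by (simp add: has_wirtinger_const)
  next
    case (Suc k)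
    from has_wirtinger_mult[OF has_wirtinger_cmult[OF cnj0, of "-1"] Suc] show ?case by simp
  qed
  have "has_wirtinger 1 (\<lambda>z. falling (of_real s) k * ((- cnj z) ^ k * disc_weight (s - real k) z))
    (falling (of_real s) k * (0 * disc_weight (s - real k) z + (- cnj z) ^ k *
      (- of_real (s - real k) * cnj z * disc_weight (s - real k - 1) z))) z"
    by (intro has_wirtinger_cmult has_wirtinger_mult pow has_wirtinger_disc_weight z)
  moreover have "falling (of_real s) k * (0 * disc_weight (s - real k) z + (- cnj z) ^ k *
      (- of_real (s - real k) * cnj z * disc_weight (s - real k - 1) z)) = weight_deriv s (Suc k) z"
  proof -
    have "s - real k - 1 = s - real (Suc k)" by simp
    then show ?thesis
      by (simp only: weight_deriv_def falling_Suc) (simp add: algebra_simps)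
  qed
  ultimately show "has_wirtinger 1 (weight_deriv s k) (weight_deriv s (Suc k) z) z"
    by (simp add: weight_deriv_def[abs_def] mult.assoc)
qed

section \<open>Power series times a branch of a power\<close>

definition convergent_on_disc :: "(nat \<Rightarrow> complex) \<Rightarrow> bool" where
  "convergent_on_disc a \<longleftrightarrow> (\<forall>u. norm u < 1 \<longrightarrow> summable (\<lambda>n. a n * u ^ n))"

lemma summable_deriv_on_disc:
  assumes "convergent_on_disc a" "norm u < 1"
  shows "summable (\<lambda>n. diffs a n * u ^ n)"
  using assms termdiff_converges[of u 1 a] by (auto simp: convergent_on_disc_def)

text \<open>
  The Euler operator \<open>u * d/du\<close> multiplies the \<open>n\<close>-th coefficient of a power series by \<open>n\<close>.
\<close>

lemma sums_euler_on_disc: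
  assumes "convergent_on_disc a" "norm u < 1"
  shows "(\<lambda>n. of_nat n * a n * u ^ n) sums (u * (\<Sum>n. diffs a n * u ^ n))"
proof -
  have "(\<lambda>n. u * (diffs a n * u ^ n)) sums (u * (\<Sum>n. diffs a n * u ^ n))"
    by (intro sums_mult summable_sums summable_deriv_on_disc assms)
  then have "(\<lambda>n. of_nat (Suc n) * a (Suc n) * u ^ Suc n) sums (u * (\<Sum>n. diffs a n * u ^ n))"
    by (simp add: diffs_def mult_ac)
  then show ?thesis
    using sums_Suc_iff[of "\<lambda>n. of_nat n * a n * u ^ n" "u * (\<Sum>n. diffs a n * u ^ n)"] by simp
qed

lemma convergent_on_disc_linear_factor:
  assumes "convergent_on_disc a"
  shows "convergent_on_disc (\<lambda>n. a n * (of_nat n + r))"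
  unfolding convergent_on_disc_def
proof (intro allI impI)
  fix u :: complex assume u: "norm u < 1"
  have "summable (\<lambda>n. of_nat n * a n * u ^ n)"
    using sums_euler_on_disc[OF assms u] by (rule sums_summable)
  moreover have "summable (\<lambda>n. r * (a n * u ^ n))"
    using assms u by (intro summable_mult) (auto simp: convergent_on_disc_def)
  ultimately have "summable (\<lambda>n. of_nat n * a n * u ^ n + r * (a n * u ^ n))"
    by (rule summable_add)
  then show "summable (\<lambda>n. a n * (of_nat n + r) * u ^ n)" by (simp add: algebra_simps)
qed

lemma convergent_on_disc_falling:
  assumes "convergent_on_disc a"
  shows "convergent_on_disc (\<lambda>n. a n * falling (of_nat n + r) k)"
proof (induction k)
  case (Suc k)
  from convergent_on_disc_linear_factor[OF this, of "r - of_nat k"]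
  show ?case by (simp add: falling_Suc algebra_simps)
qed (simp add: assms)

definition branch_series ::
    "(complex \<Rightarrow> complex) \<Rightarrow> real \<Rightarrow> (nat \<Rightarrow> complex) \<Rightarrow> complex \<Rightarrow> complex" where
  "branch_series L \<rho> a u = branch_powr L u \<rho> * (\<Sum>n. a n * u ^ n)"

text \<open>
  The restriction to the unit disc ensures that every power series under consideration converges on \<open>V\<close>.
\<close>

definition log_branch_on :: "(complex \<Rightarrow> complex) \<Rightarrow> complex set \<Rightarrow> bool" where
  "log_branch_on L V \<longleftrightarrow> open V \<and> L holomorphic_on V \<and> (\<forall>u\<in>V. exp (L u) = u \<and> norm u < 1)"

lemma local_log_branch_on_disc:
  assumes "local_log_branch L z" "norm z < 1"
  obtains V where "log_branch_on L V" "z \<in> V"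
proof -
  obtain U where "open U" "z \<in> U" "L holomorphic_on U" "\<forall>\<zeta>\<in>U. exp (L \<zeta>) = \<zeta>"
    using assms by (auto simp: local_log_branch_def)
  then have "log_branch_on L (U \<inter> ball 0 1)" "z \<in> U \<inter> ball 0 1"
    using assms(2) by (auto simp: log_branch_on_def intro: holomorphic_on_subset)
  then show ?thesis by (rule that)
qed

lemma log_branch_on_nonzero: "log_branch_on L V \<Longrightarrow> u \<in> V \<Longrightarrow> u \<noteq> 0"
  unfolding log_branch_on_def by (metis exp_not_eq_zero)

lemma log_branch_has_field_derivative:
  assumes "log_branch_on L V" "u \<in> V"
  shows "(L has_field_derivative 1 / u) (at u)"
proof -
  have V: "open V" "L holomorphic_on V" "\<And>v. v \<in> V \<Longrightarrow> exp (L v) = v"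
    using assms by (auto simp: log_branch_on_def)
  have L: "(L has_field_derivative deriv L u) (at u)"
    using V assms(2) by (intro holomorphic_derivI)
  have "((\<lambda>v. exp (L v)) has_field_derivative exp (L u) * deriv L u) (at u)"
    by (intro DERIV_chain2[OF DERIV_exp] L)
  then have "((\<lambda>v. v) has_field_derivative exp (L u) * deriv L u) (at u)"
    by (rule has_field_derivative_transform_within_open[OF _ V(1) assms(2)]) (simp add: V(3))
  then have "exp (L u) * deriv L u = 1"
    using DERIV_ident DERIV_unique by blast
  then have "deriv L u = 1 / u"
    using V(3)[OF assms(2)] by (metis exp_not_eq_zero nonzero_mult_div_cancel_left)
  with L show ?thesis by simp
qed

text \<open>
  The factor \<open>u powr \<rho>\<close> shifts the Euler operator by \<open>\<rho>\<close>, so that the coefficients are multiplied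
  by \<open>n + \<rho>\<close> while the branch itself is unchanged. This is why no derivative produces a new branch.
\<close>

lemma branch_series_has_field_derivative:
  assumes L: "log_branch_on L V" "u \<in> V" and a: "convergent_on_disc a"
  shows "(branch_series L \<rho> a has_field_derivative
           branch_series L \<rho> (\<lambda>n. a n * (of_nat n + of_real \<rho>)) u / u) (at u)"
proof -
  let ?S = "\<lambda>a u::complex. \<Sum>n. a n * u ^ n"
  have u: "norm u < 1" "u \<noteq> 0"
    using L log_branch_on_nonzero[OF L] by (auto simp: log_branch_on_def)
  have S: "(?S a has_field_derivative ?S (diffs a) u) (at u)"
    using a u by (intro termdiffs_strong'[of 1]) (auto simp: convergent_on_disc_def)
  have E: "((\<lambda>u. branch_powr L u \<rho>) has_field_derivative
      branch_powr L u \<rho> * (of_real \<rho> * (1 / u))) (at u)"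
    unfolding branch_powr_def
    by (intro DERIV_chain2[OF DERIV_exp] DERIV_cmult log_branch_has_field_derivative[OF L])
  have "(\<lambda>n. of_nat n * a n * u ^ n + of_real \<rho> * (a n * u ^ n)) sums
      (u * ?S (diffs a) u + of_real \<rho> * ?S a u)"
    using a u by (intro sums_add sums_mult sums_euler_on_disc summable_sums)
      (auto simp: convergent_on_disc_def)
  then have "(\<lambda>n. a n * (of_nat n + of_real \<rho>) * u ^ n) sums
      (u * ?S (diffs a) u + of_real \<rho> * ?S a u)"
    by (simp add: algebra_simps)
  then have "branch_series L \<rho> (\<lambda>n. a n * (of_nat n + of_real \<rho>)) u
      = branch_powr L u \<rho> * (u * ?S (diffs a) u + of_real \<rho> * ?S a u)"
    by (simp add: branch_series_def sums_unique[symmetric])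
  moreover have "(branch_series L \<rho> a has_field_derivative
      branch_powr L u \<rho> * (of_real \<rho> * (1 / u)) * ?S a u + ?S (diffs a) u * branch_powr L u \<rho>) (at u)"
    unfolding branch_series_def[abs_def] by (intro DERIV_mult E S)
  ultimately show ?thesis using u(2) by (simp add: field_simps)
qed

text \<open>
  The \<open>l\<close>-th derivative in \<open>z\<close> of \<open>branch_series L \<rho> a (z * v)\<close>. Dividing by \<open>z ^ l\<close> instead of lowering
  the exponents keeps every derivative a series in the same powers of \<open>z * v\<close>, and the dependence
  on \<open>l\<close> in the coefficients alone.
\<close>

definition branch_series_deriv ::
    "(complex \<Rightarrow> complex) \<Rightarrow> real \<Rightarrow> (nat \<Rightarrow> complex) \<Rightarrow> complex \<Rightarrow> nat \<Rightarrow> complex \<Rightarrow> complex" where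
  "branch_series_deriv L \<rho> a v l z =
     branch_series L \<rho> (\<lambda>n. a n * falling (of_nat n + of_real \<rho>) l) (z * v) / z ^ l"

text \<open>
  Differentiating the series contributes the factor \<open>n + \<rho>\<close> and differentiating \<open>1 / z ^ l\<close> the term \<open>- l\<close>;
  together they extend the falling factorial by \<open>n + \<rho> - l\<close>.
\<close>

lemma branch_series_deriv_has_field_derivative:
  assumes L: "log_branch_on L V" "z * v \<in> V" and a: "convergent_on_disc a"
  shows "(branch_series_deriv L \<rho> a v l has_field_derivative branch_series_deriv L \<rho> a v (Suc l) z) (at z)"
proof -
  let ?b = "\<lambda>n. a n * falling (of_nat n + of_real \<rho>) l"
  let ?Q = "branch_series L \<rho>"
  have nz: "z \<noteq> 0" "v \<noteq> 0" using log_branch_on_nonzero[OF L] by auto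
  have u: "norm (z * v) < 1" using L by (auto simp: log_branch_on_def)
  have b: "convergent_on_disc ?b" by (rule convergent_on_disc_falling[OF a])
  have sm: "summable (\<lambda>n. ?b n * (of_nat n + of_real \<rho>) * (z * v) ^ n)"
    "summable (\<lambda>n. ?b n * (z * v) ^ n)"
    using convergent_on_disc_linear_factor[OF b, of "of_real \<rho>"] b u
    unfolding convergent_on_disc_def by blast+
  have "(\<Sum>n. a n * falling (of_nat n + of_real \<rho>) (Suc l) * (z * v) ^ n)
      = (\<Sum>n. ?b n * (of_nat n + of_real \<rho>) * (z * v) ^ n - of_nat l * (?b n * (z * v) ^ n))"
    by (simp add: falling_Suc algebra_simps)
  also have "\<dots> = (\<Sum>n. ?b n * (of_nat n + of_real \<rho>) * (z * v) ^ n)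
      - of_nat l * (\<Sum>n. ?b n * (z * v) ^ n)"
    using sm by (simp add: suminf_diff[symmetric] suminf_mult summable_mult)
  finally have series: "(\<Sum>n. a n * falling (of_nat n + of_real \<rho>) (Suc l) * (z * v) ^ n)
      = (\<Sum>n. ?b n * (of_nat n + of_real \<rho>) * (z * v) ^ n) - of_nat l * (\<Sum>n. ?b n * (z * v) ^ n)" .
  have lower: "?Q (\<lambda>n. a n * falling (of_nat n + of_real \<rho>) (Suc l)) (z * v)
      = ?Q (\<lambda>n. ?b n * (of_nat n + of_real \<rho>)) (z * v) - of_nat l * ?Q ?b (z * v)"
    unfolding branch_series_def series by (simp only: right_diff_distrib mult.left_commute)
  have "((\<lambda>z. ?Q ?b (z * v)) has_field_derivative
      ?Q (\<lambda>n. ?b n * (of_nat n + of_real \<rho>)) (z * v) / (z * v) * v) (at z)"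
    using nz by (intro DERIV_chain2[where f = "?Q ?b" and g = "\<lambda>z. z * v", OF branch_series_has_field_derivative[OF L b]])
      (auto intro!: derivative_eq_intros)
  moreover have "((\<lambda>z. z ^ l) has_field_derivative of_nat l * z ^ l / z) (at z)"
  proof -
    have "of_nat l * z ^ l / z = of_nat l * z ^ (l - Suc 0)"
      using nz by (cases l) auto
    then show ?thesis using DERIV_power[OF DERIV_ident, where x = z and s = UNIV and n = l] by simp
  qed
  ultimately have "((\<lambda>z. ?Q ?b (z * v) / z ^ l) has_field_derivative
      (?Q (\<lambda>n. ?b n * (of_nat n + of_real \<rho>)) (z * v) / (z * v) * v * z ^ l
        - ?Q ?b (z * v) * (of_nat l * z ^ l / z)) / (z ^ l * z ^ l)) (at z)"
    using nz by (intro DERIV_divide) auto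
  moreover have "(?Q (\<lambda>n. ?b n * (of_nat n + of_real \<rho>)) (z * v) / (z * v) * v * z ^ l
        - ?Q ?b (z * v) * (of_nat l * z ^ l / z)) / (z ^ l * z ^ l)
      = branch_series_deriv L \<rho> a v (Suc l) z"
    unfolding branch_series_deriv_def lower using nz by (simp add: field_simps)
  ultimately show ?thesis by (simp add: branch_series_deriv_def[abs_def])
qed

lemma wirtinger_chain_branch_series:
  assumes "log_branch_on L V" "convergent_on_disc a" "\<And>\<zeta>. \<zeta> \<in> U \<Longrightarrow> \<zeta> * v \<in> V"
  shows "wirtinger_chain 1 U (branch_series_deriv L \<rho> a v)"
  using assms unfolding wirtinger_chain_def
  by (auto intro!: has_wirtinger_holomorphic branch_series_deriv_has_field_derivative)

lemma wirtinger_bar_chain_branch_series: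
  assumes "log_branch_on L V" "convergent_on_disc a" "\<And>\<omega>. \<omega> \<in> U \<Longrightarrow> cnj \<omega> * v \<in> V"
  shows "wirtinger_chain (-1) U (\<lambda>l \<omega>. branch_series_deriv L \<rho> a v l (cnj \<omega>))"
  using assms unfolding wirtinger_chain_def
  by (auto intro!: has_wirtinger_antiholomorphic branch_series_deriv_has_field_derivative)

section \<open>Explicit forms of the functions and of the operator\<close>

text \<open>
  The part of the Leibniz formula that does not depend on \<open>n\<close>. It is common to the functions
  and to the operator, which is the source of the identity between them.
\<close>

definition zernike_coeff :: "real \<Rightarrow> nat \<Rightarrow> nat \<Rightarrow> complex \<Rightarrow> complex" where
  "zernike_coeff \<kappa> m k z =
     of_nat (m choose k) * weight_deriv (\<kappa> + real m) k z / (disc_weight \<kappa> z * z ^ (m - k))"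

text \<open>
  The Leibniz formula applied to the series with the single coefficient \<open>a n = 1\<close>. The prefactor
  \<open>branch_powr L z (- \<rho>)\<close> removes the branch, so the result is independent of \<open>L\<close>.
\<close>

lemma fractional_zernike_explicit:
  assumes "z \<in> ball 0 1" "local_log_branch L z"
  shows "fractional_zernike L \<kappa> \<rho> m n z =
    (-1) ^ m * z ^ n * (\<Sum>k\<le>m. zernike_coeff \<kappa> m k z * falling (of_nat n + of_real \<rho>) (m - k))"
proof -
  obtain V where V: "log_branch_on L V" "z \<in> V"
    using local_log_branch_on_disc assms by auto
  have Vopen: "open V" and VD: "V \<subseteq> ball 0 1" and expL: "\<And>u. u \<in> V \<Longrightarrow> exp (L u) = u"
    using V by (auto simp: log_branch_on_def)
  let ?a = "\<lambda>k. if k = n then 1 else 0 :: complex"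
  have S: "(\<Sum>k. ?a k * f k) = f n" for f
    using sums_single[of n f] by (simp add: sums_iff if_distrib[of "\<lambda>x. x * _"] cong: if_cong)
  have a: "convergent_on_disc ?a"
    unfolding convergent_on_disc_def
  proof (intro allI impI)
    fix u :: complex
    show "summable (\<lambda>k. ?a k * u ^ k)"
      by (rule summable_finite[of "{n}"]) auto
  qed
  have Q: "branch_series_deriv L \<rho> ?a 1 l \<zeta>
      = branch_powr L \<zeta> \<rho> * (falling (of_nat n + of_real \<rho>) l * \<zeta> ^ n) / \<zeta> ^ l" for l \<zeta>
    using S[of "\<lambda>k. falling (of_nat k + of_real \<rho>) l * \<zeta> ^ k"]
    by (simp add: branch_series_deriv_def branch_series_def mult.assoc)
  have split: "branch_powr L \<zeta> (real n + \<rho>) = branch_powr L \<zeta> \<rho> * \<zeta> ^ n" if "\<zeta> \<in> V" for \<zeta>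
  proof -
    have "branch_powr L \<zeta> (real n + \<rho>) = branch_powr L \<zeta> \<rho> * exp (L \<zeta>) ^ n"
      by (simp add: branch_powr_def ring_distribs exp_add exp_of_nat_mult)
    with expL[OF that] show ?thesis by simp
  qed
  have W: "wirtinger_chain 1 V (weight_deriv (\<kappa> + real m))"
    using wirtinger_chain_weight_deriv VD by (auto simp: wirtinger_chain_def)
  have deriv: "(wirtinger ^^ m)
       (\<lambda>\<zeta>. branch_powr L \<zeta> (real n + \<rho>) * disc_weight (\<kappa> + real m) \<zeta>) z
     = (\<Sum>k\<le>m. of_nat (m choose k) * (branch_series_deriv L \<rho> ?a 1 (m - k) z
          * weight_deriv (\<kappa> + real m) k z))"
    by (rule wirtinger_chain_funpow[OF wirtinger_eqI Vopen
          wirtinger_chain_mult[OF wirtinger_chain_branch_series[OF V(1) a] W] _ V(2)])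
      (simp_all add: Q split weight_deriv_0)
  have inv: "branch_powr L z (- \<rho>) = 1 / branch_powr L z \<rho>" "branch_powr L z \<rho> \<noteq> 0"
    by (simp_all add: branch_powr_def exp_minus field_simps)
  have "disc_weight (- \<kappa>) z = 1 / disc_weight \<kappa> z"
    by (simp add: disc_weight_def powr_minus field_simps)
  then show ?thesis
    unfolding fractional_zernike_def deriv Q zernike_coeff_def sum_distrib_left
    by (intro sum.cong) (simp_all add: inv)
qed

text \<open>
  The Leibniz formula is used twice. In the variable \<open>cnj \<omega>\<close>, with \<open>\<zeta>\<close> fixed, it is needed only at
  \<open>\<omega> = w\<close>, but for all \<open>\<zeta>\<close> near \<open>z\<close>. The outcome is a combination of series in \<open>\<zeta> * cnj w\<close> with coefficients
  \<open>a n * falling (n + \<rho>) (m - j)\<close>, to which the formula applies again, in the variable \<open>\<zeta>\<close>.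
\<close>

lemma zernike_operator_explicit:
  assumes z: "z \<in> ball 0 1" and w: "w \<in> ball 0 1"
    and L: "local_log_branch L (z * cnj w)" and a: "convergent_on_disc a"
    and f: "\<And>u. f u = (\<Sum>n. a n * u ^ n)"
  shows "zernike_operator L \<kappa> \<rho> m (\<lambda>\<zeta> \<omega>. f (\<zeta> * cnj \<omega>)) z w =
    (\<Sum>k\<le>m. \<Sum>j\<le>m. zernike_coeff \<kappa> m k z * cnj (zernike_coeff \<kappa> m j w) *
      (\<Sum>n. a n * falling (of_nat n + of_real \<rho>) (m - j) * falling (of_nat n + of_real \<rho>) (m - k)
         * (z * cnj w) ^ n))"
proof -
  have "norm z * norm w < 1 * 1"
    using z w by (intro mult_strict_mono') auto
  then have "norm (z * cnj w) < 1" by (simp add: norm_mult)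
  then obtain V where V: "log_branch_on L V" "z * cnj w \<in> V"
    using local_log_branch_on_disc L by auto
  have Vopen: "open V" using V by (simp add: log_branch_on_def)
  let ?s = "\<kappa> + real m"
  let ?W = "disc_weight ?s"
  let ?T = "weight_deriv ?s"
  let ?ff = "\<lambda>l n. falling (of_nat n + of_real \<rho>) l"
  let ?F = "\<lambda>\<zeta> \<omega>. branch_powr L (\<zeta> * cnj \<omega>) \<rho> * ?W \<zeta> * ?W \<omega> * f (\<zeta> * cnj \<omega>)"
  let ?U = "ball 0 1 \<inter> (\<lambda>\<zeta>. \<zeta> * cnj w) -` V"
  have U: "open ?U" "z \<in> ?U"
    using Vopen z V by (auto intro!: open_Int open_vimage continuous_intros)
  have cnjW: "cnj (?W \<omega>) = ?W \<omega>" for \<omega> by (simp add: disc_weight_def)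
  have inner: "(wirtinger_bar ^^ m) (?F \<zeta>) w
      = (\<Sum>j\<le>m. of_nat (m choose j) *
          (?W \<zeta> * branch_series_deriv L \<rho> a \<zeta> (m - j) (cnj w) * cnj (?T j w)))"
    if "\<zeta> \<in> ?U" for \<zeta>
  proof -
    let ?V = "ball 0 1 \<inter> (\<lambda>\<omega>. cnj \<omega> * \<zeta>) -` V"
    have "wirtinger_chain (-1) ?V (\<lambda>j \<omega>. cnj (?T j \<omega>))"
      using wirtinger_chain_cnj[OF wirtinger_chain_weight_deriv, of ?s]
      by (auto simp: wirtinger_chain_def)
    moreover have "wirtinger_chain (-1) ?V (\<lambda>l \<omega>. ?W \<zeta> * branch_series_deriv L \<rho> a \<zeta> l (cnj \<omega>))"
      by (rule wirtinger_chain_cmult[OF wirtinger_bar_chain_branch_series[OF V(1) a]]) auto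
    ultimately have "wirtinger_chain (-1) ?V (\<lambda>m \<omega>. \<Sum>j\<le>m. of_nat (m choose j) *
          (?W \<zeta> * branch_series_deriv L \<rho> a \<zeta> (m - j) (cnj \<omega>) * cnj (?T j \<omega>)))"
      using wirtinger_chain_mult by blast
    moreover have "open ?V" "w \<in> ?V"
      using Vopen w that by (auto intro!: open_Int open_vimage continuous_intros simp: mult.commute)
    ultimately show ?thesis
      by (intro wirtinger_chain_funpow[OF wirtinger_bar_eqI])
        (auto simp: weight_deriv_0 cnjW branch_series_deriv_def branch_series_def f mult_ac)
  qed
  let ?c = "\<lambda>j. of_nat (m choose j) * cnj (?T j w) / cnj w ^ (m - j)"
  let ?G = "\<lambda>l \<zeta>. \<Sum>j\<le>m. ?c j * branch_series_deriv L \<rho> (\<lambda>n. a n * ?ff (m - j) n) (cnj w) l \<zeta>"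
  have G: "wirtinger_chain 1 ?U ?G"
    by (intro wirtinger_chain_lincomb wirtinger_chain_branch_series[OF V(1)]
        convergent_on_disc_falling a) auto
  have T: "wirtinger_chain 1 ?U ?T"
    using wirtinger_chain_weight_deriv by (auto simp: wirtinger_chain_def)
  (* The remaining factor, the weight in \<zeta>, is separated so that the product rule sees two chains. *)
  have eq: "(wirtinger_bar ^^ m) (?F \<zeta>) w = ?G 0 \<zeta> * ?T 0 \<zeta>" if "\<zeta> \<in> ?U" for \<zeta>
    unfolding inner[OF that] sum_distrib_right
    by (intro sum.cong) (auto simp: branch_series_deriv_def weight_deriv_0 mult_ac)
  have "(wirtinger ^^ m) (\<lambda>\<zeta>. (wirtinger_bar ^^ m) (?F \<zeta>) w) z
      = (\<Sum>k\<le>m. of_nat (m choose k) * (?G (m - k) z * ?T k z))"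
    by (rule wirtinger_chain_funpow[OF wirtinger_eqI U(1) wirtinger_chain_mult[OF G T] _ U(2)])
      (simp_all add: eq)
  then have "zernike_operator L \<kappa> \<rho> m (\<lambda>\<zeta> \<omega>. f (\<zeta> * cnj \<omega>)) z w
      = 1 / (branch_powr L (z * cnj w) \<rho> * disc_weight \<kappa> z * disc_weight \<kappa> w)
        * (\<Sum>k\<le>m. of_nat (m choose k) * (?G (m - k) z * ?T k z))"
    by (simp add: zernike_operator_def wirtinger_fst_funpow wirtinger_bar_snd_funpow)
  moreover have "branch_powr L (z * cnj w) \<rho> \<noteq> 0" by (simp add: branch_powr_def)
  moreover have "cnj (disc_weight \<kappa> w) = disc_weight \<kappa> w" by (simp add: disc_weight_def)
  ultimately show ?thesis
    unfolding branch_series_deriv_def branch_series_def zernike_coeff_def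
      sum_distrib_left sum_distrib_right
    by (auto intro!: sum.cong simp: mult_ac divide_simps)
qed

text \<open>
  By the two explicit forms both sides are built from the same convergent series
  \<open>(\<Sum>n. a n * falling (n + \<rho>) (m - j) * falling (n + \<rho>) (m - k) * (z * cnj w) ^ n)\<close>; the two signs
  \<open>(- 1) ^ m\<close> cancel. The falling factorials are invariant under conjugation since \<open>\<rho>\<close> is real.
\<close>

theorem zernike_generating_function:
  assumes z: "z \<in> ball 0 1" and w: "w \<in> ball 0 1"
    and L: "local_log_branch Lz z" "local_log_branch Lw w" "local_log_branch Lzw (z * cnj w)"
    and a: "convergent_on_disc a" and f: "\<And>u. f u = (\<Sum>n. a n * u ^ n)"
  shows "(\<lambda>n. a n * fractional_zernike Lz \<kappa> \<rho> m n z * cnj (fractional_zernike Lw \<kappa> \<rho> m n w))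
    sums zernike_operator Lzw \<kappa> \<rho> m (\<lambda>\<zeta> \<omega>. f (\<zeta> * cnj \<omega>)) z w"
proof -
  let ?ff = "\<lambda>l n. falling (of_nat n + of_real \<rho>) l"
  let ?B = "zernike_coeff \<kappa> m"
  have "norm z * norm w < 1 * 1"
    using z w by (intro mult_strict_mono') auto
  then have u: "norm (z * cnj w) < 1" by (simp add: norm_mult)
  have "(\<lambda>n. a n * ?ff (m - j) n * ?ff (m - k) n * (z * cnj w) ^ n) sums
      (\<Sum>n. a n * ?ff (m - j) n * ?ff (m - k) n * (z * cnj w) ^ n)" for j k
    using convergent_on_disc_falling[OF convergent_on_disc_falling[OF a]] u
    by (intro summable_sums) (auto simp: convergent_on_disc_def)
  then have "(\<lambda>n. \<Sum>k\<le>m. \<Sum>j\<le>m. ?B k z * cnj (?B j w) *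
        (a n * ?ff (m - j) n * ?ff (m - k) n * (z * cnj w) ^ n))
      sums zernike_operator Lzw \<kappa> \<rho> m (\<lambda>\<zeta> \<omega>. f (\<zeta> * cnj \<omega>)) z w"
    unfolding zernike_operator_explicit[where f = f, OF z w L(3) a f]
    by (intro sums_sum sums_mult)
  moreover have "(\<Sum>k\<le>m. \<Sum>j\<le>m. ?B k z * cnj (?B j w) *
        (a n * ?ff (m - j) n * ?ff (m - k) n * (z * cnj w) ^ n))
      = a n * fractional_zernike Lz \<kappa> \<rho> m n z * cnj (fractional_zernike Lw \<kappa> \<rho> m n w)" for n
  proof -
    have sgn: "(-1) ^ m * (-1) ^ m = (1 :: complex)" by (simp flip: power_mult_distrib)
    have "a n * fractional_zernike Lz \<kappa> \<rho> m n z * cnj (fractional_zernike Lw \<kappa> \<rho> m n w)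
      = ((-1) ^ m * (-1) ^ m) * a n * (z * cnj w) ^ n
        * ((\<Sum>k\<le>m. ?B k z * ?ff (m - k) n) * (\<Sum>j\<le>m. cnj (?B j w) * ?ff (m - j) n))"
      unfolding fractional_zernike_explicit[OF z L(1)] fractional_zernike_explicit[OF w L(2)]
      by (simp add: cnj_falling power_mult_distrib)
    then show ?thesis
      unfolding sgn sum_product unfolding sum_distrib_left by (simp add: mult_ac)
  qed
  ultimately show ?thesis by simp
qed

section \<open>Hypergeometric coefficients\<close>

text \<open>
  The ratio is given as a recurrence and not as a quotient because the coefficients may vanish from
  some index on, as happens when the series is a polynomial.
\<close>

lemma convergent_on_disc_ratio:
  assumes rec: "\<And>n. a (Suc n) = r n * a n" and lim: "r \<longlonglongrightarrow> l" and "norm l \<le> 1"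
  shows "convergent_on_disc a"
  unfolding convergent_on_disc_def
proof (intro allI impI)
  fix u :: complex assume u: "norm u < 1"
  have "norm l * norm u < 1"
    using u \<open>norm l \<le> 1\<close> by (metis mult_left_le_one_le norm_ge_zero order.strict_trans1)
  then obtain q where q: "norm l * norm u < q" "q < 1" using dense by blast
  have "(\<lambda>n. norm (r n) * norm u) \<longlonglongrightarrow> norm l * norm u"
    by (intro tendsto_intros lim)
  then have "eventually (\<lambda>n. norm (r n) * norm u < q) sequentially"
    using q by (intro order_tendstoD)
  then obtain N where N: "\<And>n. n \<ge> N \<Longrightarrow> norm (r n) * norm u < q"
    by (auto simp: eventually_sequentially)
  show "summable (\<lambda>n. a n * u ^ n)"
  proof (rule summable_ratio_test[OF q(2), of N])
    fix n assume "n \<ge> N"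
    have "norm (a (Suc n) * u ^ Suc n) = norm (r n) * norm u * norm (a n * u ^ n)"
      by (simp add: rec norm_mult norm_power)
    also have "\<dots> \<le> q * norm (a n * u ^ n)"
      using N[OF \<open>n \<ge> N\<close>] by (intro mult_right_mono) auto
    finally show "norm (a (Suc n) * u ^ Suc n) \<le> q * norm (a n * u ^ n)" .
  qed
qed

lemma shifted_ratio_tendsto_1: "(\<lambda>n. (x + of_nat n) / (y + of_nat n)) \<longlonglongrightarrow> (1 :: complex)"
proof -
  have "(\<lambda>n. (x / of_nat n + 1) / (y / of_nat n + 1)) \<longlonglongrightarrow> (0 + 1) / (0 + 1 :: complex)"
    by (intro tendsto_intros lim_const_over_n) auto
  moreover have "eventually (\<lambda>n. (x / of_nat n + 1) / (y / of_nat n + 1)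
      = (x + of_nat n) / (y + of_nat n)) sequentially"
    using eventually_gt_at_top[of 0]
  proof eventually_elim
    case (elim n)
    then have "x / of_nat n + 1 = (x + of_nat n) / of_nat n"
      "y / of_nat n + 1 = (y + of_nat n) / of_nat n" by (simp_all add: field_simps)
    with elim show ?case by simp
  qed
  ultimately show ?thesis by (simp add: tendsto_cong)
qed

lemma inverse_Suc_tendsto_0: "(\<lambda>n. 1 / (1 + of_nat n)) \<longlonglongrightarrow> (0 :: complex)"
  using LIMSEQ_Suc[OF lim_1_over_n[where 'a = complex]] by simp

lemma convergent_on_disc_1F1:
  "convergent_on_disc (\<lambda>n. pochhammer a n / (fact n * pochhammer c n))"
proof (rule convergent_on_disc_ratio)
  show "pochhammer a (Suc n) / (fact (Suc n) * pochhammer c (Suc n))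
      = ((a + of_nat n) / (c + of_nat n) * (1 / (1 + of_nat n)))
        * (pochhammer a n / (fact n * pochhammer c n))" for n
    by (simp add: pochhammer_Suc mult_ac)
  show "(\<lambda>n. (a + of_nat n) / (c + of_nat n) * (1 / (1 + of_nat n))) \<longlonglongrightarrow> 1 * 0"
    by (intro tendsto_mult shifted_ratio_tendsto_1 inverse_Suc_tendsto_0)
qed simp

lemma convergent_on_disc_2F1:
  "convergent_on_disc (\<lambda>n. pochhammer a n * pochhammer b n / (fact n * pochhammer c n))"
proof (rule convergent_on_disc_ratio)
  show "pochhammer a (Suc n) * pochhammer b (Suc n) / (fact (Suc n) * pochhammer c (Suc n))
      = ((a + of_nat n) / (c + of_nat n) * ((b + of_nat n) / (1 + of_nat n)))
        * (pochhammer a n * pochhammer b n / (fact n * pochhammer c n))" for n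
    by (simp add: pochhammer_Suc mult_ac)
  show "(\<lambda>n. (a + of_nat n) / (c + of_nat n) * ((b + of_nat n) / (1 + of_nat n))) \<longlonglongrightarrow> 1 * 1"
    by (intro tendsto_mult shifted_ratio_tendsto_1)
qed simp

theorem proposition3p18:
  fixes \<rho> \<kappa> :: real and m :: nat and a b c z w :: complex
    and Lz Lw Lzw :: "complex \<Rightarrow> complex"
  assumes "\<rho> > -1" and "\<kappa> > -1"
    and "c \<notin> \<int>\<^sub>\<le>\<^sub>0"
    and "z \<in> ball 0 1 - {0}" and "w \<in> ball 0 1 - {0}"
    and "local_log_branch Lz z" and "local_log_branch Lw w"
    and "local_log_branch Lzw (z * cnj w)"
  shows
    "((\<lambda>n. pochhammer a n / (fact n * pochhammer c n) *
           fractional_zernike Lz \<kappa> \<rho> m n z * cnj (fractional_zernike Lw \<kappa> \<rho> m n w))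
        sums zernike_operator Lzw \<kappa> \<rho> m (\<lambda>\<zeta> \<omega>. hypergeo_1F1 a c (\<zeta> * cnj \<omega>)) z w)
     \<and>
     ((\<lambda>n. pochhammer a n * pochhammer b n / (fact n * pochhammer c n) *
           fractional_zernike Lz \<kappa> \<rho> m n z * cnj (fractional_zernike Lw \<kappa> \<rho> m n w))
        sums zernike_operator Lzw \<kappa> \<rho> m (\<lambda>\<zeta> \<omega>. hypergeo_2F1 a b c (\<zeta> * cnj \<omega>)) z w)"
proof -
  have zw: "z \<in> ball 0 1" "w \<in> ball 0 1" using assms by auto
  show ?thesis
    by (intro conjI zernike_generating_function[OF zw assms(6-8)]
        convergent_on_disc_1F1 convergent_on_disc_2F1)
      (simp_all add: hypergeo_1F1_def hypergeo_2F1_def mult_ac)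
qed

end
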